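(* Let $X$ be a quandle with finitely many orbits and let $m=|\mathrm{Orb}(X)|$. Then $H_2^{\rm D}(X)$ is a free abelian group of rank $m$. The connecting homomorphism $\partial_*:H_3^{\rm Q}(X)\to H_2^{\rm D}(X)$ of the long exact homology sequence associated with $0\to C_*^{\rm D}(X)\stackrel{i}{\to}C_*^{\rm R}(X)\stackrel{j}{\to}C_*^{\rm Q}(X)\to0$ is the $0$-map. Hence this long exact sequence has a short exact factor $$0\to H_2^{\rm D}(X)\stackrel{i_*}{\to}H_2^{\rm R}(X)\stackrel{j_*}{\to}H_2^{\rm Q}(X)\to0.$$
   Context: A quandle is a set $X$ with a binary operation $*$ such that $a*a=a$; for all $a,b$ there is a unique $c$ with $a=c*b$; and $(a*b)*c=(a*c)*(b*c)$. The maps $S(b):a\mapsto a*b$ are automorphisms of $X$ and generate the group of inner automorphisms; $\mathrm{Orb}(X)$ is the set of orbits of this group on $X$. For $n\ge1$, $C_n^{\rm R}(X)$ is the free abelian group on $n$-tuples $(x_1,\dots,x_n)\in X^n$, $C_n^{\rm R}(X)=0$ for $n\le0$; for $n\ge2$ $$\partial_n(x_1,\dots,x_n)=\sum_{i=2}^n(-1)^i\big[(x_1,\dots,x_{i-1},x_{i+1},\dots,x_n)-(x_1*x_i,\dots,x_{i-1}*x_i,x_{i+1},\dots,x_n)\big],$$ and $\partial_n=0$ for $n\le1$. $C_n^{\rm D}(X)\subset C_n^{\rm R}(X)$ is the subgroup generated by tuples with $x_i=x_{i+1}$ for some $i\in\{1,\dots,n-1\}$ if $n\ge2$, and $0$ if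 $n\le1$; it is a subcomplex (inclusion $i$). $C_n^{\rm Q}(X)=C_n^{\rm R}(X)/C_n^{\rm D}(X)$ with induced boundary (quotient map $j$). For ${\rm W}\in\{{\rm D},{\rm R},{\rm Q}\}$, $H_n^{\rm W}(X)=H_n(C_*^{\rm W}(X))$. *)

theory Defs
  imports "HOL-Algebra.Exact_Sequence" "HOL-Algebra.Free_Abelian_Groups" "HOL-Algebra.Group_Action"
begin

section \<open>Quandles and their orbits\<close>

locale quandle =
  fixes X :: "'a set" and qop :: "'a \<Rightarrow> 'a \<Rightarrow> 'a"
  assumes closed: "\<lbrakk>a \<in> X; b \<in> X\<rbrakk> \<Longrightarrow> qop a b \<in> X"
    and idem: "a \<in> X \<Longrightarrow> qop a a = a"
    and right_division: "\<lbrakk>a \<in> X; b \<in> X\<rbrakk> \<Longrightarrow> \<exists>!c. c \<in> X \<and> a = qop c b"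
    and right_distrib:
      "\<lbrakk>a \<in> X; b \<in> X; c \<in> X\<rbrakk> \<Longrightarrow> qop (qop a b) c = qop (qop a c) (qop b c)"

definition right_translation :: "'a set \<Rightarrow> ('a \<Rightarrow> 'a \<Rightarrow> 'a) \<Rightarrow> 'a \<Rightarrow> 'a \<Rightarrow> 'a"
  where "right_translation X qop b = (\<lambda>a\<in>X. qop a b)"

definition inner_automorphism_group :: "'a set \<Rightarrow> ('a \<Rightarrow> 'a \<Rightarrow> 'a) \<Rightarrow> ('a \<Rightarrow> 'a) monoid"
  where "inner_automorphism_group X qop =
           subgroup_generated (BijGroup X) (right_translation X qop ` X)"

definition quandle_orbits :: "'a set \<Rightarrow> ('a \<Rightarrow> 'a \<Rightarrow> 'a) \<Rightarrow> 'a set set"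
  where "quandle_orbits X qop = orbits (inner_automorphism_group X qop) X (\<lambda>g. g)"

section \<open>Chain complexes of abelian groups indexed by the integers\<close>

text \<open>As usual in \<^theory>\<open>HOL-Algebra.Group\<close>, abelian groups are written multiplicatively.
  A record only carries the data; the definitions below are meant for genuine complexes,
  that is, boundary homomorphisms whose composites are trivial.\<close>

record 'c chain_complex =
  chains :: "int \<Rightarrow> 'c monoid"
  bdry :: "int \<Rightarrow> 'c \<Rightarrow> 'c"

definition cycle_group :: "'c chain_complex \<Rightarrow> int \<Rightarrow> 'c monoid"
  where "cycle_group C n =
           (chains C n)\<lparr>carrier := kernel (chains C n) (chains C (n - 1)) (bdry C n)\<rparr>"

definition boundary_set :: "'c chain_complex \<Rightarrow> int \<Rightarrow> 'c set"
  where "boundary_set C n = bdry C (n + 1) ` carrier (chains C (n + 1))"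

definition homology :: "'c chain_complex \<Rightarrow> int \<Rightarrow> 'c set monoid"
  where "homology C n = cycle_group C n Mod boundary_set C n"

definition homology_class :: "'c chain_complex \<Rightarrow> int \<Rightarrow> 'c \<Rightarrow> 'c set"
  where "homology_class C n c = boundary_set C n #>\<^bsub>cycle_group C n\<^esub> c"

text \<open>Here \<open>A\<close> is meant to be a subcomplex of \<open>C\<close>. As for induced maps on factor groups in
  \<^theory>\<open>HOL-Algebra.Coset\<close>, a map that is constant on a coset is evaluated there
  by \<^const>\<open>the_elem\<close> of the image of the coset; likewise for the induced maps and the
  connecting homomorphism below.\<close>

definition quotient_map :: "'c chain_complex \<Rightarrow> 'c chain_complex \<Rightarrow> int \<Rightarrow> 'c \<Rightarrow> 'c set"
  where "quotient_map C A n c = carrier (chains A n) #>\<^bsub>chains C n\<^esub> c"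

definition quotient_complex :: "'c chain_complex \<Rightarrow> 'c chain_complex \<Rightarrow> 'c set chain_complex"
  where "quotient_complex C A =
           \<lparr>chains = (\<lambda>n. chains C n Mod carrier (chains A n)),
            bdry = (\<lambda>n K. the_elem ((\<lambda>c. quotient_map C A (n - 1) (bdry C n c)) ` K))\<rparr>"

definition homology_map ::
    "'c chain_complex \<Rightarrow> 'd chain_complex \<Rightarrow> (int \<Rightarrow> 'c \<Rightarrow> 'd) \<Rightarrow> int \<Rightarrow> 'c set \<Rightarrow> 'd set"
  where "homology_map C D f n K = the_elem ((\<lambda>c. homology_class D n (f n c)) ` K)"

text \<open>The connecting homomorphism from \<open>homology C n\<close> to \<open>homology A (n - 1)\<close> of a short exact
  sequence of complexes with chain maps \<open>i\<close> from \<open>A\<close> to \<open>B\<close> and \<open>j\<close> from \<open>B\<close> to \<open>C\<close>: represent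
  the given class by a cycle \<open>z\<close>, lift \<open>z\<close> to a chain \<open>y\<close> of \<open>B\<close>, and take the class of
  the chain \<open>x\<close> of \<open>A\<close> that \<open>i\<close> maps to the boundary of \<open>y\<close>.\<close>

definition connecting_hom ::
    "'a chain_complex \<Rightarrow> 'b chain_complex \<Rightarrow> 'c chain_complex \<Rightarrow>
     (int \<Rightarrow> 'a \<Rightarrow> 'b) \<Rightarrow> (int \<Rightarrow> 'b \<Rightarrow> 'c) \<Rightarrow> int \<Rightarrow> 'c set \<Rightarrow> 'a set"
  where "connecting_hom A B C i j n K =
           the_elem {homology_class A (n - 1) x | x y z.
             z \<in> K \<and> y \<in> carrier (chains B n) \<and> j n y = z \<and>
             x \<in> carrier (chains A (n - 1)) \<and> i (n - 1) x = bdry B n y}"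

text \<open>The library predicate \<^const>\<open>short_exact_sequence\<close> forces all groups to have the same
  element type, which fails for a complex and its quotient.\<close>

definition short_exact ::
    "'a monoid \<Rightarrow> 'b monoid \<Rightarrow> 'c monoid \<Rightarrow> ('a \<Rightarrow> 'b) \<Rightarrow> ('b \<Rightarrow> 'c) \<Rightarrow> bool"
  where "short_exact A B C f g \<longleftrightarrow>
           group_hom A B f \<and> group_hom B C g \<and>
           inj_on f (carrier A) \<and> f ` carrier A = kernel B C g \<and> g ` carrier B = carrier C"

section \<open>The rack, degenerate and quandle complexes\<close>

text \<open>Tuples are lists; the condition \<open>1 \<le> n\<close> makes the chain group trivial for \<open>n \<le> 0\<close>.\<close>

definition tuples :: "'a set \<Rightarrow> int \<Rightarrow> 'a list set"
  where "tuples X n = {xs \<in> lists X. 1 \<le> n \<and> int (length xs) = n}"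

definition degenerate_tuples :: "'a set \<Rightarrow> int \<Rightarrow> 'a list set"
  where "degenerate_tuples X n =
           {xs \<in> tuples X n. \<exists>k. Suc k < length xs \<and> xs ! k = xs ! Suc k}"

text \<open>The entry with 1-based index \<open>i\<close> of \<open>xs\<close> is \<open>xs ! (i - 1)\<close>. On tuples of length 1 the sum is
  empty, so the boundary vanishes in all degrees \<open>n \<le> 1\<close>.\<close>

definition tuple_boundary :: "('a \<Rightarrow> 'a \<Rightarrow> 'a) \<Rightarrow> 'a list \<Rightarrow> 'a list \<Rightarrow>\<^sub>0 int"
  where "tuple_boundary qop xs =
           (\<Sum>i = 2..length xs. frag_cmul ((-1) ^ i)
              (frag_of (take (i - 1) xs @ drop i xs)
               - frag_of (map (\<lambda>a. qop a (xs ! (i - 1))) (take (i - 1) xs) @ drop i xs)))"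

definition rack_complex ::
    "'a set \<Rightarrow> ('a \<Rightarrow> 'a \<Rightarrow> 'a) \<Rightarrow> ('a list \<Rightarrow>\<^sub>0 int) chain_complex"
  where "rack_complex X qop =
           \<lparr>chains = (\<lambda>n. free_Abelian_group (tuples X n)),
            bdry = (\<lambda>n. frag_extend (tuple_boundary qop))\<rparr>"

definition degenerate_complex ::
    "'a set \<Rightarrow> ('a \<Rightarrow> 'a \<Rightarrow> 'a) \<Rightarrow> ('a list \<Rightarrow>\<^sub>0 int) chain_complex"
  where "degenerate_complex X qop =
           \<lparr>chains = (\<lambda>n. subgroup_generated (chains (rack_complex X qop) n)
                            (frag_of ` degenerate_tuples X n)),
            bdry = bdry (rack_complex X qop)\<rparr>"

definition quandle_complex ::
    "'a set \<Rightarrow> ('a \<Rightarrow> 'a \<Rightarrow> 'a) \<Rightarrow> ('a list \<Rightarrow>\<^sub>0 int) set chain_complex"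
  where "quandle_complex X qop =
           quotient_complex (rack_complex X qop) (degenerate_complex X qop)"

abbreviation incl_map :: "int \<Rightarrow> ('a list \<Rightarrow>\<^sub>0 int) \<Rightarrow> ('a list \<Rightarrow>\<^sub>0 int)"
  where "incl_map \<equiv> (\<lambda>n c. c)"

abbreviation proj_map ::
    "'a set \<Rightarrow> ('a \<Rightarrow> 'a \<Rightarrow> 'a) \<Rightarrow> int \<Rightarrow> ('a list \<Rightarrow>\<^sub>0 int) \<Rightarrow> ('a list \<Rightarrow>\<^sub>0 int) set"
  where "proj_map X qop \<equiv> quotient_map (rack_complex X qop) (degenerate_complex X qop)"

end

theory Submission
  imports Defs
begin

text \<open>In degree 2 every degenerate chain is a cycle, and the only non-trivial boundaries come from
  \<open>\<partial>(x, x, y) = (x * y, x * y) - (x, x)\<close>, so \<open>H\<^sub>2\<^sup>D\<close> is free on the orbits. The homomorphism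
  \<open>(x, y) \<mapsto> [y]\<close> from rack 2-chains to the free abelian group on the orbits kills all rack
  boundaries and induces this isomorphism on degenerate chains. Hence a rack boundary that is
  degenerate already bounds a degenerate 3-chain: this gives both the vanishing of the connecting
  homomorphism and the injectivity of \<open>i\<^sub>*\<close>. Surjectivity of \<open>j\<^sub>*\<close> holds because there are no
  degenerate 1-chains.\<close>

section \<open>Maps induced on factor groups\<close>

text \<open>Elements of one coset of \<open>N\<close> differ by elements of the kernel, so
  \<open>h\<close> is constant on the nonempty coset. All induced maps below are defined by
  \<open>the_elem\<close> and get evaluated through this.\<close>

lemma (in group_hom) the_elem_image_rcoset:
  assumes "subgroup N G" "N \<subseteq> kernel G H h" "x \<in> carrier G"
  shows "the_elem (h ` (N #> x)) = h x"
proof (rule the_elem_image_unique)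
  show "N #> x \<noteq> {}"
    using G.rcos_self assms by blast
  show "h y = h x" if "y \<in> N #> x" for y
    using that assms by (auto simp: r_coset_def kernel_def)
qed

text \<open>The universal property of the factor group supplies a homomorphism with the same values
  on representatives; multiplicativity is transferred from it to the \<open>the_elem\<close>
  formula.\<close>

lemma (in group_hom) FactGroup_the_elem_hom:
  assumes "N \<lhd> G" "N \<subseteq> kernel G H h"
  shows "(\<lambda>K. the_elem (h ` K)) \<in> hom (G Mod N) H"
proof -
  have N: "subgroup N G"
    using assms(1) by (simp add: normal_imp_subgroup)
  obtain g where "g \<in> hom (G Mod N) H" "\<And>x. x \<in> carrier G \<Longrightarrow> g (N #> x) = h x"
    using FactGroup_universal_kernel[OF assms] by blast
  moreover from this have "the_elem (h ` K) = g K" if "K \<in> carrier (G Mod N)" for K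
    using that the_elem_image_rcoset[OF N assms(2)] by (auto simp: carrier_FactGroup)
  moreover have "monoid (G Mod N)"
    using normal.factorgroup_is_group[OF assms(1)] by (rule group.is_monoid)
  ultimately show ?thesis
    by (simp add: hom_def Pi_iff monoid.m_closed del: mult_FactGroup)
qed

section \<open>Homology of complexes of abelian groups\<close>

locale abelian_complex =
  fixes C :: "'c chain_complex"
  assumes chains_comm_group: "comm_group (chains C n)"
    and bdry_hom: "bdry C n \<in> hom (chains C n) (chains C (n - 1))"
    and bdry_bdry:
      "c \<in> carrier (chains C n) \<Longrightarrow> bdry C (n - 1) (bdry C n c) = \<one>\<^bsub>chains C (n - 1 - 1)\<^esub>"
begin

lemma chains_group: "group (chains C n)"
  using chains_comm_group comm_group.axioms(2) by blast

lemma bdry_group_hom: "group_hom (chains C n) (chains C (n - 1)) (bdry C n)"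
  by (simp add: bdry_hom chains_group group_hom.intro group_hom_axioms.intro)

lemma carrier_cycle_group:
  "carrier (cycle_group C n) = kernel (chains C n) (chains C (n - 1)) (bdry C n)"
  by (simp add: cycle_group_def)

lemma cycle_iff:
  "c \<in> carrier (cycle_group C n) \<longleftrightarrow>
     c \<in> carrier (chains C n) \<and> bdry C n c = \<one>\<^bsub>chains C (n - 1)\<^esub>"
  by (simp add: carrier_cycle_group kernel_def)

lemma mult_cycle_group [simp]: "mult (cycle_group C n) = mult (chains C n)"
  and one_cycle_group [simp]: "\<one>\<^bsub>cycle_group C n\<^esub> = \<one>\<^bsub>chains C n\<^esub>"
  by (simp_all add: cycle_group_def)

lemma cycles_subgroup: "subgroup (carrier (cycle_group C n)) (chains C n)"
  by (simp add: carrier_cycle_group bdry_group_hom group_hom.subgroup_kernel)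

lemma cycle_group_comm_group: "comm_group (cycle_group C n)"
proof -
  have "group (cycle_group C n)"
    using group.subgroup_imp_group[OF chains_group cycles_subgroup[of n]]
    by (simp add: cycle_group_def)
  then show ?thesis
    by (rule group.group_comm_groupI)
      (simp add: cycle_iff comm_groupE(4)[OF chains_comm_group])
qed

lemma cycle_group_group: "group (cycle_group C n)"
  using cycle_group_comm_group comm_group.axioms(2) by blast

lemma boundaries_subgroup: "subgroup (boundary_set C n) (cycle_group C n)"
proof -
  interpret d: group_hom "chains C (n + 1)" "chains C n" "bdry C (n + 1)"
    \<comment> \<open>The target degree is \<open>n + 1 - 1\<close>, which simplifies to
      \<open>n\<close>.\<close>
    using bdry_group_hom[of "n + 1"] by simp
  have "subgroup (boundary_set C n) (chains C n)"
    unfolding boundary_set_def by (rule d.img_is_subgroup)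
  moreover have "boundary_set C n \<subseteq> carrier (cycle_group C n)"
    using bdry_bdry[of _ "n + 1"] by (auto simp: boundary_set_def cycle_iff)
  ultimately show ?thesis
    using group.subgroup_incl[OF chains_group _ cycles_subgroup, of "boundary_set C n" n]
    by (simp add: cycle_group_def)
qed

lemma boundary_cycle: "b \<in> boundary_set C n \<Longrightarrow> b \<in> carrier (cycle_group C n)"
  using subgroup.subset[OF boundaries_subgroup] by blast

lemma boundaries_normal: "boundary_set C n \<lhd> cycle_group C n"
  by (simp add: boundaries_subgroup comm_group.normal_iff_subgroup cycle_group_comm_group)

lemma homology_comm_group: "comm_group (homology C n)"
  unfolding homology_def
  by (rule comm_group.abelian_FactGroup[OF cycle_group_comm_group boundaries_subgroup])

lemma homology_group: "group (homology C n)"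
  using homology_comm_group comm_group.axioms(2) by blast

lemma one_homology: "\<one>\<^bsub>homology C n\<^esub> = boundary_set C n"
  by (simp add: homology_def)

lemma carrier_homology:
  "carrier (homology C n) = homology_class C n ` carrier (cycle_group C n)"
  by (simp add: homology_def carrier_FactGroup homology_class_def)

lemma homology_class_hom: "homology_class C n \<in> hom (cycle_group C n) (homology C n)"
  using normal.r_coset_hom_Mod[OF boundaries_normal, of n]
  by (simp add: homology_def homology_class_def[abs_def])

text \<open>A coset is trivial exactly when its representative lies in the subgroup. This moves
  questions about homology classes down to chains.\<close>

lemma homology_class_eq_one_iff:
  assumes "c \<in> carrier (cycle_group C n)"
  shows "homology_class C n c = \<one>\<^bsub>homology C n\<^esub> \<longleftrightarrow> c \<in> boundary_set C n"
  unfolding one_homology homology_class_def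
  using assms boundaries_subgroup[of n] group.coset_join1[OF cycle_group_group]
    group.coset_join2[OF cycle_group_group] subgroup.subset[OF boundaries_subgroup]
  by metis

lemma homology_class_eq:
  assumes "c \<in> carrier (cycle_group C n)" "b \<in> boundary_set C n"
  shows "homology_class C n (b \<otimes>\<^bsub>chains C n\<^esub> c) = homology_class C n c"
proof -
  have "b \<otimes>\<^bsub>cycle_group C n\<^esub> c \<in> boundary_set C n #>\<^bsub>cycle_group C n\<^esub> c"
    using assms by (auto simp: r_coset_def)
  then show ?thesis
    using group.repr_independence[OF cycle_group_group _ assms(1) boundaries_subgroup]
    by (simp add: homology_class_def)
qed

end

locale abelian_chain_map = C: abelian_complex C + D: abelian_complex D
  for C :: "'c chain_complex" and D :: "'d chain_complex" +
  fixes f :: "int \<Rightarrow> 'c \<Rightarrow> 'd"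
  assumes map_hom: "f n \<in> hom (chains C n) (chains D n)"
    and bdry_map: "c \<in> carrier (chains C n) \<Longrightarrow> bdry D n (f n c) = f (n - 1) (bdry C n c)"
begin

lemma map_cycle: "c \<in> carrier (cycle_group C n) \<Longrightarrow> f n c \<in> carrier (cycle_group D n)"
  using hom_carrier[OF map_hom[of n]] hom_one[OF map_hom C.chains_group D.chains_group]
  by (auto simp: C.cycle_iff D.cycle_iff bdry_map)

lemma map_boundary: "c \<in> boundary_set C n \<Longrightarrow> f n c \<in> boundary_set D n"
  using hom_carrier[OF map_hom[of "n + 1"]] bdry_map[of _ "n + 1"]
  by (force simp: boundary_set_def)

lemma homology_class_map_group_hom:
  "group_hom (cycle_group C n) (homology D n) (\<lambda>c. homology_class D n (f n c))"
proof -
  have "f n \<in> hom (cycle_group C n) (cycle_group D n)"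
    using hom_mult[OF map_hom] by (auto intro!: homI simp: map_cycle C.cycle_iff)
  from hom_compose[OF this D.homology_class_hom] show ?thesis
    by (simp add: group_hom.intro group_hom_axioms.intro C.cycle_group_group D.homology_group
        comp_def)
qed

text \<open>A chain map sends boundaries to boundaries. With this the map from cycles of
  \<open>C\<close> to homology classes of \<open>D\<close> factors through
  \<open>homology C n\<close>.\<close>

lemma boundaries_subset_kernel:
  "boundary_set C n \<subseteq> kernel (cycle_group C n) (homology D n) (\<lambda>c. homology_class D n (f n c))"
proof
  fix b assume b: "b \<in> boundary_set C n"
  then have "b \<in> carrier (cycle_group C n)"
    by (rule C.boundary_cycle)
  then show "b \<in> kernel (cycle_group C n) (homology D n) (\<lambda>c. homology_class D n (f n c))"
    using b by (simp add: kernel_def map_cycle D.homology_class_eq_one_iff map_boundary)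
qed

lemma homology_map_class:
  assumes "c \<in> carrier (cycle_group C n)"
  shows "homology_map C D f n (homology_class C n c) = homology_class D n (f n c)"
  unfolding homology_map_def homology_class_def[of C]
  by (rule group_hom.the_elem_image_rcoset[OF homology_class_map_group_hom
        C.boundaries_subgroup boundaries_subset_kernel assms])

lemma homology_map_group_hom:
  "group_hom (homology C n) (homology D n) (homology_map C D f n)"
proof -
  have "homology_map C D f n \<in> hom (homology C n) (homology D n)"
    using group_hom.FactGroup_the_elem_hom[OF homology_class_map_group_hom
        C.boundaries_normal boundaries_subset_kernel, of n]
    by (simp add: homology_map_def[abs_def] homology_def[of C])
  then show ?thesis
    by (simp add: group_hom.intro group_hom_axioms.intro C.homology_group D.homology_group)
qed

end

section \<open>Subcomplexes and their quotients\<close>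

text \<open>\<open>chains_sub_eq\<close> and \<open>bdry_sub_eq\<close> give \<open>A\<close>
  literally the operations of \<open>C\<close>, so the inclusion is the identity on chains and
  rewriting moves terms between the two complexes.\<close>

locale abelian_subcomplex = abelian_complex C for C :: "'c chain_complex" +
  fixes A :: "'c chain_complex"
  assumes sub_chains: "subgroup (carrier (chains A n)) (chains C n)"
    and chains_sub_eq: "chains A n = (chains C n)\<lparr>carrier := carrier (chains A n)\<rparr>"
    and bdry_sub_eq: "bdry A = bdry C"
    and bdry_sub_closed:
      "c \<in> carrier (chains A n) \<Longrightarrow> bdry C n c \<in> carrier (chains A (n - 1))"
begin

abbreviation "Q \<equiv> quotient_complex C A"
abbreviation "q \<equiv> quotient_map C A"

lemma mult_sub: "mult (chains A n) = mult (chains C n)"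
  by (subst chains_sub_eq) simp

lemma one_sub: "\<one>\<^bsub>chains A n\<^esub> = \<one>\<^bsub>chains C n\<^esub>"
  by (subst chains_sub_eq) simp

lemma sub_carrier: "c \<in> carrier (chains A n) \<Longrightarrow> c \<in> carrier (chains C n)"
  using subgroup.subset[OF sub_chains] by blast

lemma abelian_complex_sub: "abelian_complex A"
proof (rule abelian_complex.intro)
  fix n
  have "group (chains A n)"
    by (subst chains_sub_eq) (rule group.subgroup_imp_group[OF chains_group sub_chains])
  then show "comm_group (chains A n)"
    by (rule group.group_comm_groupI)
      (simp add: mult_sub sub_carrier comm_groupE(4)[OF chains_comm_group])
  show "bdry A n \<in> hom (chains A n) (chains A (n - 1))"
    by (auto intro!: homI simp: bdry_sub_eq bdry_sub_closed mult_sub sub_carrier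
        hom_mult[OF bdry_hom])
  show "bdry A (n - 1) (bdry A n c) = \<one>\<^bsub>chains A (n - 1 - 1)\<^esub>"
    if "c \<in> carrier (chains A n)" for c
    using that by (simp add: bdry_sub_eq one_sub bdry_bdry sub_carrier)
qed

sublocale A: abelian_complex A
  by (rule abelian_complex_sub)

sublocale incl: abelian_chain_map A C "\<lambda>n c. c"
proof
  show "(\<lambda>c. c) \<in> hom (chains A n) (chains C n)" for n
    by (auto intro!: homI simp: mult_sub sub_carrier)
qed (simp add: bdry_sub_eq)

lemma sub_normal: "carrier (chains A n) \<lhd> chains C n"
  by (simp add: sub_chains comm_group.normal_iff_subgroup chains_comm_group)

lemma chains_quotient: "chains Q n = chains C n Mod carrier (chains A n)"
  by (simp add: quotient_complex_def)

lemma carrier_quotient: "carrier (chains Q n) = q n ` carrier (chains C n)"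
  by (simp add: chains_quotient carrier_FactGroup quotient_map_def)

lemma one_quotient: "\<one>\<^bsub>chains Q n\<^esub> = carrier (chains A n)"
  by (simp add: chains_quotient)

lemma quotient_comm_group: "comm_group (chains Q n)"
  unfolding chains_quotient
  by (rule comm_group.abelian_FactGroup[OF chains_comm_group sub_chains])

lemma quotient_map_hom: "q n \<in> hom (chains C n) (chains Q n)"
  using normal.r_coset_hom_Mod[OF sub_normal, of n]
  by (simp add: chains_quotient quotient_map_def[abs_def])

lemma quotient_map_eq_one_iff:
  assumes "c \<in> carrier (chains C n)"
  shows "q n c = \<one>\<^bsub>chains Q n\<^esub> \<longleftrightarrow> c \<in> carrier (chains A n)"
  unfolding one_quotient quotient_map_def
  using assms sub_chains[of n] group.coset_join1[OF chains_group]
    group.coset_join2[OF chains_group] subgroup.subset[OF sub_chains]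
  by metis

lemma quotient_bdry_group_hom:
  "group_hom (chains C n) (chains Q (n - 1)) (\<lambda>c. q (n - 1) (bdry C n c))"
  using hom_compose[OF bdry_hom quotient_map_hom, of n] quotient_comm_group[of "n - 1"]
  by (simp add: group_hom.intro group_hom_axioms.intro chains_group comm_group.axioms(2)
      comp_def)

lemma sub_subset_kernel:
  "carrier (chains A n) \<subseteq> kernel (chains C n) (chains Q (n - 1)) (\<lambda>c. q (n - 1) (bdry C n c))"
proof
  fix a assume a: "a \<in> carrier (chains A n)"
  then have "bdry C n a \<in> carrier (chains A (n - 1))"
    by (rule bdry_sub_closed)
  then show "a \<in> kernel (chains C n) (chains Q (n - 1)) (\<lambda>c. q (n - 1) (bdry C n c))"
    using a by (simp add: kernel_def sub_carrier quotient_map_eq_one_iff)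
qed

text \<open>The boundary maps \<open>A\<close> into \<open>A\<close>, so its composite with
  \<open>q\<close> kills \<open>A\<close> and is constant on the coset \<open>q n c\<close>.\<close>

lemma bdry_quotient:
  assumes "c \<in> carrier (chains C n)"
  shows "bdry Q n (q n c) = q (n - 1) (bdry C n c)"
proof -
  have "the_elem ((\<lambda>c. q (n - 1) (bdry C n c)) ` q n c) = q (n - 1) (bdry C n c)"
    unfolding quotient_map_def[of C A n c]
    by (rule group_hom.the_elem_image_rcoset[OF quotient_bdry_group_hom
        sub_chains sub_subset_kernel assms])
  then show ?thesis
    by (simp add: quotient_complex_def)
qed

lemma abelian_complex_quotient: "abelian_complex Q"
proof (rule abelian_complex.intro)
  fix n
  show "comm_group (chains Q n)"
    by (rule quotient_comm_group)
  show "bdry Q n \<in> hom (chains Q n) (chains Q (n - 1))"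
    using group_hom.FactGroup_the_elem_hom[OF quotient_bdry_group_hom
        sub_normal sub_subset_kernel, of n]
    by (simp add: quotient_complex_def)
  show "bdry Q (n - 1) (bdry Q n z) = \<one>\<^bsub>chains Q (n - 1 - 1)\<^esub>"
    if z: "z \<in> carrier (chains Q n)" for z
  proof -
    obtain c where c: "c \<in> carrier (chains C n)" "z = q n c"
      using z by (auto simp: carrier_quotient)
    then have "bdry C n c \<in> carrier (chains C (n - 1))"
      using hom_carrier[OF bdry_hom] by blast
    then show ?thesis
      using c monoid.one_closed[OF group.is_monoid[OF A.chains_group]]
      by (simp add: bdry_quotient bdry_bdry quotient_map_eq_one_iff sub_carrier flip: one_sub)
  qed
qed

sublocale Q: abelian_complex Q
  by (rule abelian_complex_quotient)

sublocale proj: abelian_chain_map C Q q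
  by unfold_locales (simp_all add: quotient_map_hom bdry_quotient)

section \<open>The connecting homomorphism and exactness in homology\<close>

lemma lift_quotient_cycle:
  assumes "z \<in> carrier (cycle_group Q n)"
  obtains y where "y \<in> carrier (chains C n)" "z = q n y"
    "bdry C n y \<in> carrier (chains A (n - 1))"
proof -
  obtain y where y: "y \<in> carrier (chains C n)" "z = q n y"
    using assms by (auto simp: Q.cycle_iff carrier_quotient)
  moreover have "bdry C n y \<in> carrier (chains C (n - 1))"
    using y hom_carrier[OF bdry_hom] by blast
  \<comment> \<open>The lift \<open>y\<close> need not be a cycle: that \<open>z\<close> is one says
    only that \<open>q\<close> kills the boundary of \<open>y\<close>.\<close>
  ultimately have "bdry C n y \<in> carrier (chains A (n - 1))"
    using assms by (simp add: Q.cycle_iff bdry_quotient quotient_map_eq_one_iff)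
  with y that show ?thesis by blast
qed

text \<open>By \<open>sub\<close>, each admissible choice of \<open>x\<close>, \<open>y\<close>,
  \<open>z\<close> gives the trivial class, because \<open>x\<close> is a boundary of
  \<open>C\<close> lying in \<open>A\<close>. Independence of the choices comes along with
  this.\<close>

lemma connecting_hom_eq_one:
  assumes sub: "boundary_set C (n - 1) \<inter> carrier (chains A (n - 1)) \<subseteq> boundary_set A (n - 1)"
    and K: "K \<in> carrier (homology Q n)"
  shows "connecting_hom A C Q (\<lambda>n c. c) q n K = \<one>\<^bsub>homology A (n - 1)\<^esub>"
proof -
  let ?S = "{homology_class A (n - 1) x | x y z.
             z \<in> K \<and> y \<in> carrier (chains C n) \<and> q n y = z \<and>
             x \<in> carrier (chains A (n - 1)) \<and> x = bdry C n y}"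
  have one: "homology_class A (n - 1) (bdry C n y) = \<one>\<^bsub>homology A (n - 1)\<^esub>"
    if "y \<in> carrier (chains C n)" "bdry C n y \<in> carrier (chains A (n - 1))" for y
  proof -
    have "bdry C n y \<in> boundary_set C (n - 1)"
      using that(1) by (auto simp: boundary_set_def)
    then have "bdry C n y \<in> boundary_set A (n - 1)"
      using sub that(2) by blast
    then show ?thesis
      using subgroup.subset[OF A.boundaries_subgroup] A.homology_class_eq_one_iff by blast
  qed
  \<comment> \<open>\<open>the_elem\<close> needs a singleton, so \<open>?S\<close> must also be
    shown nonempty, by lifting one representative of \<open>K\<close>.\<close>
  obtain z where z: "z \<in> carrier (cycle_group Q n)" "K = homology_class Q n z"
    using K unfolding Q.carrier_homology by blast
  obtain y where y: "y \<in> carrier (chains C n)" "z = q n y"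
    "bdry C n y \<in> carrier (chains A (n - 1))"
    using z(1) by (rule lift_quotient_cycle)
  have "z \<in> K"
    unfolding z(2) homology_class_def
    by (rule group.rcos_self[OF Q.cycle_group_group z(1) Q.boundaries_subgroup])
  then have "homology_class A (n - 1) (bdry C n y) \<in> ?S"
    using y by blast
  then have "?S = {\<one>\<^bsub>homology A (n - 1)\<^esub>}"
    using y one by fastforce
  then show ?thesis
    by (simp add: connecting_hom_def)
qed

text \<open>A class in the kernel is represented by a cycle of \<open>A\<close> that bounds in
  \<open>C\<close>; by \<open>sub\<close> it already bounds in \<open>A\<close>.\<close>

lemma homology_map_incl_inj:
  assumes sub: "boundary_set C n \<inter> carrier (chains A n) \<subseteq> boundary_set A n"
  shows "inj_on (homology_map A C (\<lambda>n c. c) n) (carrier (homology A n))"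
proof -
  interpret i: group_hom "homology A n" "homology C n" "homology_map A C (\<lambda>n c. c) n"
    by (rule incl.homology_map_group_hom)
  have "a = \<one>\<^bsub>homology A n\<^esub>"
    if a: "a \<in> kernel (homology A n) (homology C n) (homology_map A C (\<lambda>n c. c) n)" for a
  proof -
    obtain x where x: "x \<in> carrier (cycle_group A n)" "a = homology_class A n x"
      using a by (auto simp: kernel_def A.carrier_homology)
    then have "x \<in> boundary_set C n"
      using a by (simp add: kernel_def incl.homology_map_class incl.map_cycle
          homology_class_eq_one_iff)
    then show ?thesis
      using x sub by (auto simp: A.homology_class_eq_one_iff A.cycle_iff)
  qed
  then show ?thesis
    by (auto simp: i.inj_iff_trivial_ker kernel_def)
qed

lemma homology_exact:
  "homology_map A C (\<lambda>n c. c) n ` carrier (homology A n) =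
     kernel (homology C n) (homology Q n) (homology_map C Q q n)"
proof (intro equalityI subsetI)
  fix K assume "K \<in> homology_map A C (\<lambda>n c. c) n ` carrier (homology A n)"
  then obtain a where a: "a \<in> carrier (cycle_group A n)"
      "K = homology_map A C (\<lambda>n c. c) n (homology_class A n a)"
    by (auto simp: A.carrier_homology)
  then have K: "K = homology_class C n a" and aC: "a \<in> carrier (cycle_group C n)"
    by (simp_all add: incl.homology_map_class incl.map_cycle)
  have "q n a = \<one>\<^bsub>chains Q n\<^esub>"
    using a(1) by (simp add: A.cycle_iff sub_carrier quotient_map_eq_one_iff)
  then have "q n a \<in> boundary_set Q n"
    using subgroup.one_closed[OF Q.boundaries_subgroup] by simp
  then show "K \<in> kernel (homology C n) (homology Q n) (homology_map C Q q n)"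
    by (simp add: K kernel_def carrier_homology aC proj.homology_map_class
        Q.homology_class_eq_one_iff proj.map_cycle)
next
  fix K assume K: "K \<in> kernel (homology C n) (homology Q n) (homology_map C Q q n)"
  then obtain y where y: "y \<in> carrier (cycle_group C n)" "K = homology_class C n y"
    by (auto simp: kernel_def carrier_homology)
  then have "q n y \<in> boundary_set Q n"
    using K by (simp add: kernel_def proj.homology_map_class Q.homology_class_eq_one_iff
        proj.map_cycle)
  then obtain w where w: "w \<in> carrier (chains C (n + 1))" "q n y = q n (bdry C (n + 1) w)"
    using bdry_quotient[of _ "n + 1"] carrier_quotient[of "n + 1"]
    by (auto simp: boundary_set_def)
  interpret c: group "cycle_group C n"
    by (rule cycle_group_group)
  define b where "b = bdry C (n + 1) w"
  have b: "b \<in> boundary_set C n"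
    using w(1) by (auto simp: boundary_set_def b_def)
  then have bc: "b \<in> carrier (cycle_group C n)"
    using subgroup.subset[OF boundaries_subgroup] by blast
  \<comment> \<open>\<open>w\<close> lifts a chain of \<open>Q\<close> whose boundary is
    \<open>q n y\<close>. Dividing \<open>y\<close> by the boundary \<open>b\<close> of
    \<open>w\<close> keeps the homology class and moves the representative into
    \<open>A\<close>.\<close>
  define a where "a = inv\<^bsub>cycle_group C n\<^esub> b \<otimes>\<^bsub>chains C n\<^esub> y"
  have ac: "a \<in> carrier (cycle_group C n)"
    using c.m_closed[OF c.inv_closed[OF bc] y(1)] by (simp add: a_def)
  have "y = b \<otimes>\<^bsub>chains C n\<^esub> a"
    using c.inv_solve_left[OF ac bc y(1)] by (simp add: a_def)
  then have "q n b \<otimes>\<^bsub>chains Q n\<^esub> q n a = q n b"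
    using w(2) hom_mult[OF quotient_map_hom, of b n a] ac bc by (simp add: b_def cycle_iff)
  moreover have "q n b \<in> carrier (chains Q n)" "q n a \<in> carrier (chains Q n)"
    using ac bc by (auto simp: carrier_quotient cycle_iff)
  ultimately have "q n a = \<one>\<^bsub>chains Q n\<^esub>"
    using group.l_cancel_one[OF Q.chains_group] by blast
  then have "a \<in> carrier (cycle_group A n)"
    using ac by (simp add: A.cycle_iff cycle_iff quotient_map_eq_one_iff one_sub bdry_sub_eq)
  moreover have "homology_class C n a = K"
  proof -
    have "inv\<^bsub>cycle_group C n\<^esub> b \<in> boundary_set C n"
      using b by (simp add: subgroup.m_inv_closed[OF boundaries_subgroup])
    then show ?thesis
      using y by (simp add: a_def homology_class_eq)
  qed
  ultimately show "K \<in> homology_map A C (\<lambda>n c. c) n ` carrier (homology A n)"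
    by (force simp: A.carrier_homology incl.homology_map_class)
qed

text \<open>The boundary of a lift of a quotient cycle lies in \<open>A\<close> one degree lower. If
  that group is trivial, the lift is itself a cycle.\<close>

lemma homology_map_proj_surj:
  assumes "carrier (chains A (n - 1)) = {\<one>\<^bsub>chains A (n - 1)\<^esub>}"
  shows "homology_map C Q q n ` carrier (homology C n) = carrier (homology Q n)"
proof -
  have "K \<in> homology_map C Q q n ` carrier (homology C n)" if K: "K \<in> carrier (homology Q n)" for K
  proof -
    obtain z where z: "z \<in> carrier (cycle_group Q n)" "K = homology_class Q n z"
      using K unfolding Q.carrier_homology by blast
    obtain y where y: "y \<in> carrier (chains C n)" "z = q n y"
      "bdry C n y \<in> carrier (chains A (n - 1))"
      using z(1) by (rule lift_quotient_cycle)
    then have "y \<in> carrier (cycle_group C n)"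
      using assms by (simp add: cycle_iff one_sub)
    then show ?thesis
      using y z by (force simp: carrier_homology proj.homology_map_class)
  qed
  moreover have "homology_map C Q q n ` carrier (homology C n) \<subseteq> carrier (homology Q n)"
    using group_hom.homh[OF proj.homology_map_group_hom] by (rule hom_carrier)
  ultimately show ?thesis by blast
qed

lemma short_exact_homology:
  assumes "boundary_set C n \<inter> carrier (chains A n) \<subseteq> boundary_set A n"
    and "carrier (chains A (n - 1)) = {\<one>\<^bsub>chains A (n - 1)\<^esub>}"
  shows "short_exact (homology A n) (homology C n) (homology Q n)
           (homology_map A C (\<lambda>n c. c) n) (homology_map C Q q n)"
  unfolding short_exact_def
  using assms by (intro conjI incl.homology_map_group_hom proj.homology_map_group_hom
      homology_map_incl_inj homology_exact homology_map_proj_surj)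

end

section \<open>The rack complex and its degenerate subcomplex\<close>

lemma keys_frag_extend_subset:
  assumes "\<And>x. x \<in> Poly_Mapping.keys c \<Longrightarrow> Poly_Mapping.keys (f x) \<subseteq> S"
  shows "Poly_Mapping.keys (frag_extend f c) \<subseteq> S"
  using keys_frag_extend[of f c] assms by blast

lemma keys_diff_subset:
  "Poly_Mapping.keys a \<subseteq> S \<Longrightarrow> Poly_Mapping.keys b \<subseteq> S \<Longrightarrow> Poly_Mapping.keys (a - b) \<subseteq> S"
  using keys_diff[of a b] by blast

lemma frag_cmul_diff: "frag_cmul k (a - b) = frag_cmul k a - frag_cmul k b"
  by (simp add: poly_mapping_eq_iff fun_eq_iff lookup_minus algebra_simps)

lemma frag_cmul_cancel:
  "frag_cmul k a + frag_cmul (- k) a = 0" "frag_cmul (- k) a + frag_cmul k a = 0"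
  by (simp_all flip: frag_cmul_distrib)

lemma frag_extend_hom:
  assumes "\<And>x. x \<in> S \<Longrightarrow> Poly_Mapping.keys (f x) \<subseteq> T"
  shows "frag_extend f \<in> hom (free_Abelian_group S) (free_Abelian_group T)"
proof (rule homI)
  fix c assume "c \<in> carrier (free_Abelian_group S)"
  then show "frag_extend f c \<in> carrier (free_Abelian_group T)"
    unfolding carrier_free_Abelian_group_iff
    by (intro keys_frag_extend_subset) (use assms in blast)
qed (simp add: frag_extend_add)

text \<open>This allows membership in the degenerate chain groups to be tested on supports
  alone.\<close>

lemma generate_free_Abelian_group:
  assumes "T \<subseteq> S"
  shows "generate (free_Abelian_group S) (frag_of ` T) = {c. Poly_Mapping.keys c \<subseteq> T}"
proof (intro equalityI subsetI)
  interpret F: group "free_Abelian_group S" by simp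
  fix c
  show "c \<in> {c. Poly_Mapping.keys c \<subseteq> T}" if "c \<in> generate (free_Abelian_group S) (frag_of ` T)"
    using that
  proof induction
    case (inv h)
    then show ?case using assms by auto
  next
    case (eng a b)
    then show ?case using keys_add[of a b] by auto
  qed auto
  assume "c \<in> {c. Poly_Mapping.keys c \<subseteq> T}"
  then have "Poly_Mapping.keys c \<subseteq> T" by simp
  then show "c \<in> generate (free_Abelian_group S) (frag_of ` T)"
  proof (induction c rule: frag_induction)
    case zero
    then show ?case
      using generate.one[of "free_Abelian_group S"] by simp
  next
    case (diff a b)
    \<comment> \<open>\<open>frag_induction\<close> asks for differences while
      \<open>generate\<close> offers products, so \<open>a - b\<close> is treated as the product of
      \<open>a\<close> with the inverse of \<open>b\<close>.\<close>
    then have "inv\<^bsub>free_Abelian_group S\<^esub> b \<in> generate (free_Abelian_group S) (frag_of ` T)"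
      using assms by (intro F.generate_m_inv_closed) auto
    moreover have "b \<in> carrier (free_Abelian_group S)"
      using diff assms by (intro F.generate_in_carrier[of "frag_of ` T"]) auto
    ultimately have "- b \<in> generate (free_Abelian_group S) (frag_of ` T)"
      by simp
    from generate.eng[OF diff(1) this] show ?case
      by simp
  qed (simp add: generate.incl)
qed

section \<open>Recursion of the boundary on the last entry\<close>

definition append_chain :: "'a \<Rightarrow> ('a list \<Rightarrow>\<^sub>0 int) \<Rightarrow> 'a list \<Rightarrow>\<^sub>0 int"
  where "append_chain y = frag_extend (\<lambda>xs. frag_of (xs @ [y]))"

definition act_chain :: "('a \<Rightarrow> 'a \<Rightarrow> 'a) \<Rightarrow> 'a \<Rightarrow> ('a list \<Rightarrow>\<^sub>0 int) \<Rightarrow> 'a list \<Rightarrow>\<^sub>0 int"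
  where "act_chain qop y = frag_extend (\<lambda>xs. frag_of (map (\<lambda>a. qop a y) xs))"

lemma append_chain_simps [simp]:
  "append_chain y 0 = 0" "append_chain y (frag_of xs) = frag_of (xs @ [y])"
  "append_chain y (c - d) = append_chain y c - append_chain y d"
  "append_chain y (c + d) = append_chain y c + append_chain y d"
  "append_chain y (frag_cmul k c) = frag_cmul k (append_chain y c)"
  by (simp_all add: append_chain_def frag_extend_diff frag_extend_add frag_extend_cmul)

lemma act_chain_simps [simp]:
  "act_chain qop y 0 = 0" "act_chain qop y (frag_of xs) = frag_of (map (\<lambda>a. qop a y) xs)"
  "act_chain qop y (c - d) = act_chain qop y c - act_chain qop y d"
  "act_chain qop y (c + d) = act_chain qop y c + act_chain qop y d"
  "act_chain qop y (frag_cmul k c) = frag_cmul k (act_chain qop y c)"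
  by (simp_all add: act_chain_def frag_extend_diff frag_extend_add frag_extend_cmul)

lemma keys_append_chain:
  assumes "Poly_Mapping.keys c \<subseteq> S" "\<And>xs. xs \<in> S \<Longrightarrow> xs @ [y] \<in> T"
  shows "Poly_Mapping.keys (append_chain y c) \<subseteq> T"
  unfolding append_chain_def using assms by (intro keys_frag_extend_subset) auto

lemma act_append_chain:
  "act_chain qop y (append_chain z c) = append_chain (qop z y) (act_chain qop y c)"
proof -
  \<comment> \<open>The trivial support bound is there to start
    \<open>frag_induction\<close>.\<close>
  have "Poly_Mapping.keys c \<subseteq> UNIV" by simp
  then show ?thesis
    by (induction c rule: frag_induction) simp_all
qed

lemma tuple_boundary_Nil [simp]: "tuple_boundary qop [] = 0"
  by (simp add: tuple_boundary_def)

text \<open>This recursion is what makes \<open>\<partial>\<partial> = 0\<close> and the invariance of degenerate chains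
  provable by induction on the tuple.\<close>

lemma tuple_boundary_snoc:
  "tuple_boundary qop (xs @ [y]) = append_chain y (tuple_boundary qop xs) +
     frag_cmul ((-1) ^ Suc (length xs)) (frag_of xs - frag_of (map (\<lambda>a. qop a y) xs))"
proof (cases "xs = []")
  case True
  then show ?thesis by (simp add: tuple_boundary_def)
next
  \<comment> \<open>For nonempty \<open>xs\<close> the index \<open>Suc (length xs)\<close> is at
    least 2, so the term deleting \<open>y\<close> really occurs and splits off; for empty
    \<open>xs\<close> both sides are 0.\<close>
  case False
  let ?t = "\<lambda>ys i. frag_cmul ((-1) ^ i) (frag_of (take (i - 1) ys @ drop i ys)
               - frag_of (map (\<lambda>a. qop a (ys ! (i - 1))) (take (i - 1) ys) @ drop i ys))"
  have "append_chain y (tuple_boundary qop xs) = (\<Sum>i = 2..length xs. append_chain y (?t xs i))"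
    by (simp add: tuple_boundary_def append_chain_def frag_extend_sum comp_def)
  also have "\<dots> = (\<Sum>i = 2..length xs. ?t (xs @ [y]) i)"
  proof (rule sum.cong)
    fix i assume "i \<in> {2..length xs}"
    then have "(xs @ [y]) ! (i - 1) = xs ! (i - 1)"
      by (auto simp: nth_append)
    with \<open>i \<in> {2..length xs}\<close> show "append_chain y (?t xs i) = ?t (xs @ [y]) i"
      by simp
  qed simp
  finally show ?thesis
    using False by (simp add: tuple_boundary_def Suc_le_eq numeral_2_eq_2)
qed

lemma tuple_boundary_singleton [simp]: "tuple_boundary qop [x] = 0"
  using tuple_boundary_snoc[of qop "[]" x] by simp

lemma tuple_boundary_pair: "tuple_boundary qop [x, y] = frag_of [x] - frag_of [qop x y]"
  using tuple_boundary_snoc[of qop "[x]" y] by simp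

lemma tuple_boundary_triple:
  "tuple_boundary qop [x, y, z] =
     frag_of [x, z] - frag_of [qop x y, z] - (frag_of [x, y] - frag_of [qop x z, qop y z])"
  using tuple_boundary_snoc[of qop "[x, y]" z] by (simp add: tuple_boundary_pair)

text \<open>The linear extension of the recursion. All tuples must have one length \<open>k\<close>,
  since the sign depends on it.\<close>

lemma frag_extend_boundary_append_chain:
  assumes "Poly_Mapping.keys c \<subseteq> {zs. length zs = k}"
  shows "frag_extend (tuple_boundary qop) (append_chain y c) =
     append_chain y (frag_extend (tuple_boundary qop) c) +
     frag_cmul ((-1) ^ Suc k) (c - act_chain qop y c)"
  using assms
proof (induction c rule: frag_induction)
  case (one zs)
  then show ?case by (simp add: tuple_boundary_snoc)
next
  case (diff a b)
  then show ?case
    by (simp add: frag_extend_diff frag_cmul_diff)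
qed simp

text \<open>The equal neighbours either both lie in \<open>xs\<close> or are the last two entries.
  This fits induction from the right end of the tuple.\<close>

lemma degenerate_snoc_cases:
  assumes "Suc k < length (xs @ [y])" "(xs @ [y]) ! k = (xs @ [y]) ! Suc k"
  obtains "Suc k < length xs" "xs ! k = xs ! Suc k" | zs where "xs = zs @ [y]"
proof (cases "Suc k < length xs")
  case True
  with assms that(1) show thesis by (simp add: nth_append)
next
  case False
  with assms(1) have k: "length xs = Suc k" by simp
  then obtain zs w where xs: "xs = zs @ [w]"
    by (metis length_Suc_conv_rev)
  with k assms(2) have "w = y" by (simp add: nth_append)
  with xs that(2) show thesis by blast
qed

lemma degenerate_snoc:
  assumes "xs \<in> degenerate_tuples X n" "y \<in> X"
  shows "xs @ [y] \<in> degenerate_tuples X (n + 1)"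
proof -
  obtain k where k: "Suc k < length xs" "xs ! k = xs ! Suc k"
    using assms(1) by (auto simp: degenerate_tuples_def)
  then have "Suc k < length (xs @ [y]) \<and> (xs @ [y]) ! k = (xs @ [y]) ! Suc k"
    by (simp add: nth_append)
  moreover have "xs @ [y] \<in> tuples X (n + 1)"
    using assms by (auto simp: degenerate_tuples_def tuples_def)
  ultimately show ?thesis
    unfolding degenerate_tuples_def by blast
qed

lemma degenerate_snoc_snoc:
  assumes "xs \<in> tuples X n" "y \<in> X"
  shows "xs @ [y] @ [y] \<in> degenerate_tuples X (n + 2)"
proof -
  have "Suc (length xs) < length (xs @ [y] @ [y]) \<and>
      (xs @ [y] @ [y]) ! length xs = (xs @ [y] @ [y]) ! Suc (length xs)"
    by (simp add: nth_append)
  moreover have "xs @ [y] @ [y] \<in> tuples X (n + 2)"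
    using assms by (auto simp: tuples_def)
  ultimately show ?thesis
    unfolding degenerate_tuples_def by blast
qed

context quandle
begin

section \<open>Consequences of the quandle axioms for the boundary\<close>

lemma map_qop_lists: "xs \<in> lists X \<Longrightarrow> y \<in> X \<Longrightarrow> map (\<lambda>a. qop a y) xs \<in> lists X"
  by (induction xs) (auto simp: closed)

lemma keys_tuple_boundary:
  assumes "xs \<in> lists X"
  shows "Poly_Mapping.keys (tuple_boundary qop xs) \<subseteq> tuples X (int (length xs) - 1)"
  using assms
proof (induction xs rule: rev_induct)
  case (snoc y xs)
  have "Poly_Mapping.keys (append_chain y (tuple_boundary qop xs)) \<subseteq> tuples X (int (length xs))"
    using snoc by (intro keys_append_chain[of _ "tuples X (int (length xs) - 1)"])
      (auto simp: tuples_def)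
  moreover have "Poly_Mapping.keys (frag_of xs - frag_of (map (\<lambda>a. qop a y) xs))
      \<subseteq> tuples X (int (length xs))"
  \<comment> \<open>For \<open>xs = []\<close> the set \<open>tuples X 0\<close> is empty, but the
    two terms cancel and the support is empty too.\<close>
  proof (cases "xs = []")
    case False
    then show ?thesis
      using snoc.prems map_qop_lists[of xs y]
      by (intro keys_diff_subset) (auto simp: tuples_def Suc_le_eq)
  qed simp
  ultimately show ?case
    using keys_add[of "append_chain y (tuple_boundary qop xs)"]
      keys_cmul[of "(-1) ^ Suc (length xs)" "frag_of xs - frag_of (map (\<lambda>a. qop a y) xs)"]
    by (simp add: tuple_boundary_snoc del: power_Suc) blast
qed simp

text \<open>Right distributivity makes translation by \<open>y\<close> an endomorphism of the
  operation, hence compatible with the boundary.\<close>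

lemma act_chain_tuple_boundary:
  assumes "xs \<in> lists X" "y \<in> X"
  shows "act_chain qop y (tuple_boundary qop xs) = tuple_boundary qop (map (\<lambda>a. qop a y) xs)"
  using assms(1)
proof (induction xs rule: rev_induct)
  case (snoc z xs)
  have "map (\<lambda>a. qop (qop a z) y) xs = map (\<lambda>a. qop (qop a y) (qop z y)) xs"
    using snoc assms(2) by (auto simp: right_distrib)
  then have "map (\<lambda>a. qop a y) (map (\<lambda>a. qop a z) xs) =
      map (\<lambda>a. qop a (qop z y)) (map (\<lambda>a. qop a y) xs)"
    by simp
  moreover have "act_chain qop y (tuple_boundary qop xs) =
      tuple_boundary qop (map (\<lambda>a. qop a y) xs)"
    using snoc by simp
  ultimately show ?case
    by (simp only: tuple_boundary_snoc act_append_chain act_chain_simps map_append list.map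
        length_map)
qed simp

text \<open>Apply the recursion twice. The term with \<open>y\<close> appended vanishes by
  induction; the two remaining terms carry opposite signs, because the boundary of \<open>xs\<close>
  is one entry shorter, and they cancel as the action of \<open>y\<close> commutes with the
  boundary.\<close>

lemma boundary_tuple_boundary:
  assumes "xs \<in> lists X"
  shows "frag_extend (tuple_boundary qop) (tuple_boundary qop xs) = 0"
  using assms
proof (induction xs rule: rev_induct)
  case (snoc y xs)
  show ?case
  proof (cases "xs = []")
    case False
    \<comment> \<open>Here \<open>length xs - 1\<close> is a natural number; \<open>xs\<close> is
      nonempty, so its successor is \<open>length xs\<close> and the signs match up.\<close>
    have "Poly_Mapping.keys (tuple_boundary qop xs) \<subseteq> {zs. length zs = length xs - 1}"
      using keys_tuple_boundary[of xs] snoc by (force simp: tuples_def)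
    then show ?thesis
      using snoc False
      by (simp add: tuple_boundary_snoc frag_extend_add frag_extend_boundary_append_chain
          frag_extend_cmul frag_extend_diff act_chain_tuple_boundary frag_cmul_cancel)
  qed simp
qed simp

lemma keys_tuple_boundary_degenerate:
  assumes "xs \<in> lists X" "Suc k < length xs" "xs ! k = xs ! Suc k"
  shows "Poly_Mapping.keys (tuple_boundary qop xs)
           \<subseteq> degenerate_tuples X (int (length xs) - 1)"
  using assms
proof (induction xs arbitrary: k rule: rev_induct)
  case (snoc y xs)
  from snoc.prems(2,3) show ?case
  proof (cases rule: degenerate_snoc_cases)
    case 1
    have xs: "xs \<in> lists X" "y \<in> X" using snoc.prems by auto
    have "Poly_Mapping.keys (tuple_boundary qop xs)
        \<subseteq> degenerate_tuples X (int (length xs) - 1)"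
      using snoc.IH xs 1 by blast
    then have "Poly_Mapping.keys (append_chain y (tuple_boundary qop xs))
        \<subseteq> degenerate_tuples X (int (length xs))"
      using degenerate_snoc[OF _ xs(2), of _ "int (length xs) - 1"]
      by (intro keys_append_chain[of _ "degenerate_tuples X (int (length xs) - 1)"]) simp_all
    moreover have "Poly_Mapping.keys (frag_of xs - frag_of (map (\<lambda>a. qop a y) xs))
        \<subseteq> degenerate_tuples X (int (length xs))"
    proof -
      have "map (\<lambda>a. qop a y) xs ! k = map (\<lambda>a. qop a y) xs ! Suc k"
        using 1 by simp
      then show ?thesis
        using 1 xs map_qop_lists[OF xs]
        by (intro keys_diff_subset) (auto simp: degenerate_tuples_def tuples_def)
    qed
    ultimately show ?thesis
      using keys_add[of "append_chain y (tuple_boundary qop xs)"]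
        keys_cmul[of "(-1) ^ Suc (length xs)" "frag_of xs - frag_of (map (\<lambda>a. qop a y) xs)"]
      by (simp add: tuple_boundary_snoc del: power_Suc) blast
  next
    case (2 zs)
    have zs: "zs \<in> lists X" "y \<in> X" using snoc.prems 2 by auto
    \<comment> \<open>Deleting either of the two final copies of \<open>y\<close> gives the same
      terms with opposite signs, once idempotence replaces \<open>qop y y\<close> by
      \<open>y\<close>.\<close>
    have "tuple_boundary qop (xs @ [y]) = append_chain y (append_chain y (tuple_boundary qop zs))"
      using zs idem tuple_boundary_snoc[of qop "zs @ [y]" y] tuple_boundary_snoc[of qop zs y]
      by (simp add: 2 frag_cmul_cancel)
    moreover have "Poly_Mapping.keys (append_chain y (append_chain y (tuple_boundary qop zs)))
        \<subseteq> degenerate_tuples X (int (length xs))"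
    proof (rule keys_append_chain)
      \<comment> \<open>The intermediate set remembers that its tuples end in \<open>y\<close>, so
        that appending \<open>y\<close> again creates equal neighbours.\<close>
      show "Poly_Mapping.keys (append_chain y (tuple_boundary qop zs))
          \<subseteq> (\<lambda>ws. ws @ [y]) ` tuples X (int (length zs) - 1)"
        using keys_tuple_boundary[OF zs(1)] by (rule keys_append_chain) simp
      show "ws @ [y] \<in> degenerate_tuples X (int (length xs))"
        if "ws \<in> (\<lambda>ws. ws @ [y]) ` tuples X (int (length zs) - 1)" for ws
        using that degenerate_snoc_snoc[OF _ zs(2), of _ "int (length zs) - 1"] 2 by auto
    qed
    ultimately show ?thesis by simp
  qed
qed simp

section \<open>The rack complex and the degenerate subcomplex as instances of the locales\<close>

lemma abelian_complex_rack: "abelian_complex (rack_complex X qop)"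
proof (rule abelian_complex.intro)
  fix n
  show "comm_group (chains (rack_complex X qop) n)"
    by (simp add: rack_complex_def abelian_free_Abelian_group)
  show "bdry (rack_complex X qop) n
      \<in> hom (chains (rack_complex X qop) n) (chains (rack_complex X qop) (n - 1))"
  proof -
    have "Poly_Mapping.keys (tuple_boundary qop xs) \<subseteq> tuples X (n - 1)" if "xs \<in> tuples X n" for xs
      using keys_tuple_boundary[of xs] that by (simp add: tuples_def[of X n])
    then show ?thesis
      by (simp add: rack_complex_def frag_extend_hom)
  qed
  show "bdry (rack_complex X qop) (n - 1) (bdry (rack_complex X qop) n c)
      = \<one>\<^bsub>chains (rack_complex X qop) (n - 1 - 1)\<^esub>"
    if "c \<in> carrier (chains (rack_complex X qop) n)" for c
  proof -
    have "Poly_Mapping.keys c \<subseteq> tuples X n"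
      using that by (simp add: rack_complex_def)
    then have "frag_extend (tuple_boundary qop) (frag_extend (tuple_boundary qop) c) = 0"
      by (induction c rule: frag_induction)
        (simp_all add: boundary_tuple_boundary tuples_def frag_extend_diff)
    then show ?thesis
      by (simp add: rack_complex_def)
  qed
qed

lemma carrier_degenerate:
  "carrier (chains (degenerate_complex X qop) n) =
     {c. Poly_Mapping.keys c \<subseteq> degenerate_tuples X n}"
proof -
  have sub: "degenerate_tuples X n \<subseteq> tuples X n"
    by (auto simp: degenerate_tuples_def)
  \<comment> \<open>\<open>subgroup_generated\<close> intersects the generators with the carrier
    first; here the intersection changes nothing.\<close>
  then have "carrier (free_Abelian_group (tuples X n)) \<inter> frag_of ` degenerate_tuples X n =
      frag_of ` degenerate_tuples X n"
    by auto
  then show ?thesis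
    by (simp add: degenerate_complex_def rack_complex_def carrier_subgroup_generated
        generate_free_Abelian_group[OF sub])
qed

lemma abelian_subcomplex_degenerate:
  "abelian_subcomplex (rack_complex X qop) (degenerate_complex X qop)"
proof (intro abelian_subcomplex.intro abelian_subcomplex_axioms.intro abelian_complex_rack)
  fix n
  show "subgroup (carrier (chains (degenerate_complex X qop) n)) (chains (rack_complex X qop) n)"
    by (simp add: degenerate_complex_def rack_complex_def group.subgroup_subgroup_generated)
  show "chains (degenerate_complex X qop) n = (chains (rack_complex X qop) n)
      \<lparr>carrier := carrier (chains (degenerate_complex X qop) n)\<rparr>"
    by (simp add: degenerate_complex_def subgroup_generated_def)
  show "bdry (degenerate_complex X qop) = bdry (rack_complex X qop)"
    by (simp add: degenerate_complex_def)
  show "bdry (rack_complex X qop) n c \<in> carrier (chains (degenerate_complex X qop) (n - 1))"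
    if "c \<in> carrier (chains (degenerate_complex X qop) n)" for c
  proof -
    have "Poly_Mapping.keys (tuple_boundary qop xs) \<subseteq> degenerate_tuples X (n - 1)"
      if xs: "xs \<in> degenerate_tuples X n" for xs
    proof -
      obtain k where "Suc k < length xs" "xs ! k = xs ! Suc k"
        using xs by (auto simp: degenerate_tuples_def)
      moreover have "xs \<in> lists X" "int (length xs) = n"
        using xs by (auto simp: degenerate_tuples_def tuples_def)
      ultimately show ?thesis
        using keys_tuple_boundary_degenerate[of xs k] by simp
    qed
    then show ?thesis
      using that unfolding carrier_degenerate rack_complex_def
      by (auto intro!: keys_frag_extend_subset simp del: subset_iff)
  qed
qed

sublocale DR: abelian_subcomplex "rack_complex X qop" "degenerate_complex X qop"
  by (rule abelian_subcomplex_degenerate)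

section \<open>Orbits\<close>

text \<open>In \<open>right_division\<close>, existence gives surjectivity and uniqueness gives
  injectivity; the restriction to \<open>X\<close> provides the extensionality that
  \<open>Bij\<close> demands.\<close>

lemma right_translation_Bij:
  assumes "b \<in> X"
  shows "right_translation X qop b \<in> Bij X"
proof -
  have "bij_betw (right_translation X qop b) X X"
    unfolding bij_betw_def inj_on_def right_translation_def
    using right_division[OF _ assms] closed[OF _ assms] by (auto simp: image_iff) metis+
  then show ?thesis
    by (simp add: Bij_def right_translation_def)
qed

lemma right_translations_subset: "right_translation X qop ` X \<subseteq> carrier (BijGroup X)"
  using right_translation_Bij by (auto simp: BijGroup_def)

lemma right_translation_inner:
  "b \<in> X \<Longrightarrow> right_translation X qop b \<in> carrier (inner_automorphism_group X qop)"
  using group.subgroup_generated_subset_carrier_subset[OF group_BijGroup right_translations_subset]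
  by (auto simp: inner_automorphism_group_def)

text \<open>The action is the inclusion of a subgroup into \<open>BijGroup X\<close>, hence a
  homomorphism.\<close>

lemma inner_action: "group_action (inner_automorphism_group X qop) X (\<lambda>g. g)"
proof -
  have "(\<lambda>g. g) \<in> hom (inner_automorphism_group X qop) (BijGroup X)"
    using group.carrier_subgroup_generated_subset[OF group_BijGroup]
    by (auto simp: hom_def inner_automorphism_group_def)
  then show ?thesis
    by (simp add: group_action_def group_hom_def group_hom_axioms_def group_BijGroup
        inner_automorphism_group_def group.group_subgroup_generated)
qed

sublocale inner: group_action "inner_automorphism_group X qop" X "\<lambda>g. g"
  by (rule inner_action)

abbreviation orbit_of :: "'a \<Rightarrow> 'a set"
  where "orbit_of \<equiv> orbit (inner_automorphism_group X qop) (\<lambda>g. g)"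

lemma orbit_of_in_orbits: "x \<in> X \<Longrightarrow> orbit_of x \<in> quandle_orbits X qop"
  by (auto simp: quandle_orbits_def orbits_def)

lemma orbit_of_eq:
  assumes "x \<in> X" "y \<in> orbit_of x"
  shows "orbit_of y = orbit_of x"
proof -
  have "y \<in> X"
    using assms inner.element_image by (auto simp: orbit_def)
  then show ?thesis
    using assms inner.orbit_refl inner.disjoint_union[of "orbit_of x" "orbit_of y"]
      orbit_of_in_orbits by (auto simp: quandle_orbits_def)
qed

lemma orbit_of_qop:
  assumes "x \<in> X" "y \<in> X"
  shows "orbit_of (qop x y) = orbit_of x"
proof (rule orbit_of_eq[OF assms(1)])
  show "qop x y \<in> orbit_of x"
    using assms right_translation_inner[of y]
    by (auto simp: orbit_def right_translation_def intro!: exI[of _ "right_translation X qop y"])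
qed

section \<open>The second homology groups\<close>

lemma boundary_set_rack:
  "boundary_set (rack_complex X qop) n =
     frag_extend (tuple_boundary qop) ` {c. Poly_Mapping.keys c \<subseteq> tuples X (n + 1)}"
proof -
  have "carrier (free_Abelian_group (tuples X (n + 1))) =
      {c. Poly_Mapping.keys c \<subseteq> tuples X (n + 1)}"
    by auto
  then show ?thesis
    by (simp add: boundary_set_def rack_complex_def)
qed

lemma boundary_set_degenerate:
  "boundary_set (degenerate_complex X qop) n =
     frag_extend (tuple_boundary qop) ` {c. Poly_Mapping.keys c \<subseteq> degenerate_tuples X (n + 1)}"
  unfolding boundary_set_def carrier_degenerate
  by (simp add: degenerate_complex_def rack_complex_def)

lemma boundary_set_degenerate_0: "0 \<in> boundary_set (degenerate_complex X qop) n"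
  unfolding boundary_set_degenerate by (rule image_eqI[of _ _ 0]) auto

lemma boundary_set_degenerate_diff:
  assumes "a \<in> boundary_set (degenerate_complex X qop) n"
    and "b \<in> boundary_set (degenerate_complex X qop) n"
  shows "a - b \<in> boundary_set (degenerate_complex X qop) n"
proof -
  obtain u v where "Poly_Mapping.keys u \<subseteq> degenerate_tuples X (n + 1)"
      "a = frag_extend (tuple_boundary qop) u"
      "Poly_Mapping.keys v \<subseteq> degenerate_tuples X (n + 1)"
      "b = frag_extend (tuple_boundary qop) v"
    using assms by (auto simp: boundary_set_degenerate)
  then show ?thesis
    unfolding boundary_set_degenerate
    by (intro image_eqI[of _ _ "u - v"]) (simp_all add: frag_extend_diff keys_diff_subset)
qed

lemma boundary_set_degenerate_add:
  assumes "a \<in> boundary_set (degenerate_complex X qop) n"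
    and "b \<in> boundary_set (degenerate_complex X qop) n"
  shows "a + b \<in> boundary_set (degenerate_complex X qop) n"
  using boundary_set_degenerate_diff[OF assms(1) boundary_set_degenerate_diff[OF
        boundary_set_degenerate_0 assms(2)]] by simp

lemma tuples_2: "tuples X 2 = {[x, y] | x y. x \<in> X \<and> y \<in> X}"
  by (auto simp: tuples_def length_Suc_conv numeral_2_eq_2)

lemma tuples_3: "tuples X 3 = {[x, y, z] | x y z. x \<in> X \<and> y \<in> X \<and> z \<in> X}"
  by (auto simp: tuples_def length_Suc_conv numeral_3_eq_3)

lemma degenerate_tuples_1: "degenerate_tuples X 1 = {}"
  by (auto simp: tuples_def degenerate_tuples_def)

lemma degenerate_tuples_2: "degenerate_tuples X 2 = {[x, x] | x. x \<in> X}"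
  by (auto simp: degenerate_tuples_def tuples_2)

text \<open>Diagonal pairs along one orbit are homologous in the degenerate complex: a single
  translation is handled by an explicit 3-chain, and a word in translations and their inverses by
  telescoping.\<close>

lemma diagonal_boundary:
  assumes "x \<in> X" "g \<in> carrier (inner_automorphism_group X qop)"
  shows "frag_of [x, x] - frag_of [g x, g x] \<in> boundary_set (degenerate_complex X qop) 2"
proof -
  let ?B = "boundary_set (degenerate_complex X qop) 2"
  let ?G = "BijGroup X"
  have step: "frag_of [x, x] - frag_of [qop x y, qop x y] \<in> ?B" if "x \<in> X" "y \<in> X" for x y
    unfolding boundary_set_degenerate
  proof (rule image_eqI)
    \<comment> \<open>In the boundary of \<open>[x, x, y]\<close> the terms ending in
      \<open>y\<close> cancel by idempotence and the rest has the opposite sign, hence the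
      minus.\<close>
    show "frag_of [x, x] - frag_of [qop x y, qop x y] =
        frag_extend (tuple_boundary qop) (- frag_of [x, x, y])"
      using that by (simp add: frag_extend_minus tuple_boundary_triple idem[OF that(1)])
    have "Suc 0 < length [x, x, y] \<and> [x, x, y] ! 0 = [x, x, y] ! Suc 0"
      by simp
    then have "[x, x, y] \<in> degenerate_tuples X 3"
      using that unfolding degenerate_tuples_def tuples_3 by blast
    then show "- frag_of [x, x, y] \<in> {c. Poly_Mapping.keys c \<subseteq> degenerate_tuples X (2 + 1)}"
      by simp
  qed
  have "g \<in> generate ?G (right_translation X qop ` X)"
    using assms(2) right_translations_subset
    by (simp add: inner_automorphism_group_def carrier_subgroup_generated Int_absorb1)
  then show ?thesis
    using assms(1)
  \<comment> \<open>The base point must vary, since a product applies its left factor at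
    \<open>h x\<close>.\<close>
  proof (induction arbitrary: x)
    case one
    then show ?case
      using boundary_set_degenerate_0 by (simp add: BijGroup_def)
  next
    case (incl h)
    then obtain b where "b \<in> X" "h = right_translation X qop b"
      by blast
    then show ?case
      using step[OF incl.prems] incl.prems by (simp add: right_translation_def)
  next
    case (inv h)
    then obtain b where b: "b \<in> X" "h = right_translation X qop b"
      by blast
    have h: "h \<in> Bij X"
      using b right_translation_Bij by simp
    \<comment> \<open>For an inverse translation, \<open>step\<close> is used at the preimage
      \<open>y\<close> of \<open>x\<close> and the result is negated.\<close>
    define y where "y = inv_into X h x"
    have y: "(inv\<^bsub>?G\<^esub> h) x = y" "y \<in> X" "h y = x"
      using h inv.prems Bij_inv_into_mem[OF h]
      by (simp_all add: inv_BijGroup y_def Bij_def bij_betw_def f_inv_into_f)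
    then have "frag_of [y, y] - frag_of [x, x] \<in> ?B"
      using step[OF y(2) b(1)] y(2) unfolding y(3)[symmetric]
      by (simp add: b(2) right_translation_def)
    from boundary_set_degenerate_diff[OF boundary_set_degenerate_0 this] show ?case
      by (simp add: y)
  next
    case (eng g h)
    have "g \<in> carrier ?G" "h \<in> carrier ?G"
      using eng.hyps group.generate_in_carrier[OF group_BijGroup right_translations_subset]
      by blast+
    then have gh: "g \<in> Bij X" "h \<in> Bij X"
      by (simp_all add: BijGroup_def)
    then have "h x \<in> X"
      using Bij_imp_funcset eng.prems by blast
    moreover have "(g \<otimes>\<^bsub>?G\<^esub> h) x = g (h x)"
      using gh eng.prems by (simp add: BijGroup_def compose_eq)
    ultimately show ?case
      \<comment> \<open>Telescoping: the diagonal pair at \<open>h x\<close> cancels between the two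
        differences.\<close>
      using boundary_set_degenerate_add[OF eng.IH(2)[OF eng.prems] eng.IH(1)[of "h x"]]
      by simp
  qed
qed

section \<open>The orbit invariant of 2-chains and its section\<close>

definition orbit_class :: "('a list \<Rightarrow>\<^sub>0 int) \<Rightarrow> ('a set \<Rightarrow>\<^sub>0 int)"
  where "orbit_class = frag_extend (\<lambda>xs. frag_of (orbit_of (last xs)))"

lemma orbit_class_hom:
  "orbit_class \<in> hom (free_Abelian_group (tuples X 2)) (free_Abelian_group (quandle_orbits X qop))"
  unfolding orbit_class_def
  by (rule frag_extend_hom) (auto simp: tuples_2 orbit_of_in_orbits)

text \<open>In the boundary of \<open>[x, y, z]\<close> two terms end in \<open>z\<close> with
  opposite signs; the other two end in \<open>y\<close> and \<open>qop y z\<close>, which share an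
  orbit.\<close>

lemma orbit_class_boundary:
  assumes "b \<in> boundary_set (rack_complex X qop) 2"
  shows "orbit_class b = 0"
proof -
  obtain c where "Poly_Mapping.keys c \<subseteq> tuples X 3" and b: "b = frag_extend (tuple_boundary qop) c"
    using assms by (auto simp: boundary_set_rack)
  then show ?thesis
    unfolding b
    by (induction c rule: frag_induction)
      (auto simp: tuples_3 orbit_class_def frag_extend_diff tuple_boundary_triple orbit_of_qop)
qed

text \<open>A right inverse of \<open>orbit_class\<close> on chains supported on orbits. Orbits are
  nonempty, so the choice of \<open>r\<close> is meaningful there.\<close>

definition diagonal_section :: "('a set \<Rightarrow>\<^sub>0 int) \<Rightarrow> ('a list \<Rightarrow>\<^sub>0 int)"
  where "diagonal_section = frag_extend (\<lambda>T. let r = SOME r. r \<in> T in frag_of [r, r])"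

lemma orbit_representative:
  assumes "T \<in> quandle_orbits X qop"
  shows "(SOME r. r \<in> T) \<in> X" "orbit_of (SOME r. r \<in> T) = T"
proof -
  obtain x where x: "x \<in> X" "T = orbit_of x"
    using assms by (auto simp: quandle_orbits_def orbits_def)
  then have r: "(SOME r. r \<in> T) \<in> T"
    using inner.orbit_refl[OF x(1)] by (auto intro: someI)
  then show "orbit_of (SOME r. r \<in> T) = T"
    using x orbit_of_eq by simp
  show "(SOME r. r \<in> T) \<in> X"
    using r x inner.orbits_coverture orbit_of_in_orbits[OF x(1)]
    by (auto simp: quandle_orbits_def)
qed

text \<open>Each \<open>[x, x]\<close> may be moved to the chosen representative of its orbit, which
  is \<open>g x\<close> for some inner automorphism \<open>g\<close>;
  \<open>diagonal_boundary\<close> pays for the move.\<close>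

lemma diff_diagonal_section:
  assumes "Poly_Mapping.keys c \<subseteq> degenerate_tuples X 2"
  shows "c - diagonal_section (orbit_class c) \<in> boundary_set (degenerate_complex X qop) 2"
  using assms
proof (induction c rule: frag_induction)
  case zero
  then show ?case
    using boundary_set_degenerate_0 by (simp add: orbit_class_def diagonal_section_def)
next
  case (one xs)
  then obtain x where x: "x \<in> X" "xs = [x, x]"
    by (auto simp: degenerate_tuples_2)
  then have "(SOME r. r \<in> orbit_of x) \<in> orbit_of x"
    using inner.orbit_refl[OF x(1)] by (auto intro: someI)
  then obtain g where "g \<in> carrier (inner_automorphism_group X qop)"
      "(SOME r. r \<in> orbit_of x) = g x"
    by (auto simp: orbit_def)
  then show ?case
    using diagonal_boundary[OF x(1)] x(2)
    by (simp add: orbit_class_def diagonal_section_def Let_def)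
next
  case (diff a b)
  then show ?case
    using boundary_set_degenerate_diff[OF diff]
    by (simp add: orbit_class_def diagonal_section_def frag_extend_diff algebra_simps)
qed

text \<open>Degenerate boundaries are rack boundaries, which \<open>orbit_class\<close> kills.
  Conversely, if the class is 0, the correction term in \<open>diff_diagonal_section\<close>
  vanishes.\<close>

lemma degenerate_boundary_iff:
  assumes "Poly_Mapping.keys c \<subseteq> degenerate_tuples X 2"
  shows "c \<in> boundary_set (degenerate_complex X qop) 2 \<longleftrightarrow> orbit_class c = 0"
proof
  assume "c \<in> boundary_set (degenerate_complex X qop) 2"
  then have "c \<in> boundary_set (rack_complex X qop) 2"
    by (rule DR.incl.map_boundary)
  then show "orbit_class c = 0"
    by (rule orbit_class_boundary)
next
  assume "orbit_class c = 0"
  then show "c \<in> boundary_set (degenerate_complex X qop) 2"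
    using diff_diagonal_section[OF assms] by (simp add: diagonal_section_def)
qed

lemma degenerate_boundaries:
  "boundary_set (rack_complex X qop) 2 \<inter> carrier (chains (degenerate_complex X qop) 2)
     \<subseteq> boundary_set (degenerate_complex X qop) 2"
  by (auto simp: carrier_degenerate degenerate_boundary_iff orbit_class_boundary)

text \<open>A 1-tuple has no neighbouring entries. The degree stays \<open>2 - 1\<close> to match
  \<open>short_exact_homology\<close> at \<open>n = 2\<close>.\<close>

lemma degenerate_chains_1:
  "carrier (chains (degenerate_complex X qop) (2 - 1)) =
     {\<one>\<^bsub>chains (degenerate_complex X qop) (2 - 1)\<^esub>}"
  by (simp add: carrier_degenerate degenerate_tuples_1 DR.one_sub) (simp add: rack_complex_def)

lemma degenerate_cycles_2:
  "c \<in> carrier (cycle_group (degenerate_complex X qop) 2) \<longleftrightarrow>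
     Poly_Mapping.keys c \<subseteq> degenerate_tuples X 2"
proof -
  have "bdry (degenerate_complex X qop) 2 c = \<one>\<^bsub>chains (degenerate_complex X qop) (2 - 1)\<^esub>"
    if "c \<in> carrier (chains (degenerate_complex X qop) 2)"
    using hom_in_carrier[OF DR.A.bdry_hom that] degenerate_chains_1 by blast
  then show ?thesis
    unfolding DR.A.cycle_iff by (auto simp: carrier_degenerate)
qed

text \<open>First isomorphism theorem for \<open>orbit_class\<close> on degenerate cycles:
  \<open>diagonal_section\<close> gives surjectivity, \<open>degenerate_boundary_iff\<close> the
  kernel.\<close>

lemma homology_degenerate_iso:
  "homology (degenerate_complex X qop) 2 \<cong> free_Abelian_group (quandle_orbits X qop)"
proof -
  let ?Z = "cycle_group (degenerate_complex X qop) 2"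
  let ?F = "free_Abelian_group (quandle_orbits X qop)"
  have "degenerate_tuples X 2 \<subseteq> tuples X 2"
    by (auto simp: degenerate_tuples_def)
  then have "orbit_class \<in> hom ?Z ?F"
    using orbit_class_hom
    by (auto simp: hom_def Pi_iff degenerate_cycles_2 DR.mult_sub rack_complex_def)
  then interpret c: group_hom ?Z ?F orbit_class
    by (simp add: group_hom_def group_hom_axioms_def DR.A.cycle_group_group)
  have "c \<in> orbit_class ` carrier ?Z" if "Poly_Mapping.keys c \<subseteq> quandle_orbits X qop" for c
  proof
    show "diagonal_section c \<in> carrier ?Z"
      unfolding degenerate_cycles_2 diagonal_section_def
      using that orbit_representative
      by (intro keys_frag_extend_subset) (auto simp: degenerate_tuples_2 Let_def)
    show "c = orbit_class (diagonal_section c)"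
      using that
      by (induction c rule: frag_induction)
        (simp_all add: orbit_class_def diagonal_section_def frag_extend_diff Let_def
          orbit_representative)
  qed
  then have "orbit_class ` carrier ?Z = carrier ?F"
    using c.hom_closed by auto
  moreover have "kernel ?Z ?F orbit_class = boundary_set (degenerate_complex X qop) 2"
    using DR.A.boundary_cycle[of _ 2] degenerate_boundary_iff
    unfolding kernel_def degenerate_cycles_2 one_free_Abelian_group mem_Collect_eq by blast
  ultimately show ?thesis
    using c.FactGroup_iso by (simp add: homology_def)
qed

end

theorem proposition3p9:
  fixes X :: "'a set" and qop :: "'a \<Rightarrow> 'a \<Rightarrow> 'a" and m :: nat
  assumes "quandle X qop"
    and "finite (quandle_orbits X qop)"
    and "m = card (quandle_orbits X qop)"
  shows "homology (degenerate_complex X qop) 2 \<cong> free_Abelian_group {..<m}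
    \<and> (\<forall>\<kappa> \<in> carrier (homology (quandle_complex X qop) 3).
         connecting_hom (degenerate_complex X qop) (rack_complex X qop) (quandle_complex X qop)
             incl_map (proj_map X qop) 3 \<kappa>
           = \<one>\<^bsub>homology (degenerate_complex X qop) 2\<^esub>)
    \<and> short_exact
         (homology (degenerate_complex X qop) 2)
         (homology (rack_complex X qop) 2)
         (homology (quandle_complex X qop) 2)
         (homology_map (degenerate_complex X qop) (rack_complex X qop) incl_map 2)
         (homology_map (rack_complex X qop) (quandle_complex X qop) (proj_map X qop) 2)"
proof (intro conjI ballI)
  interpret quandle X qop by (rule assms(1))
  \<comment> \<open>Equipotent bases give isomorphic free abelian groups, which turns the orbit set
    into the rank \<open>m\<close>.\<close>
  have "quandle_orbits X qop \<approx> {..<m}"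
    using assms(2,3) by (simp add: eqpoll_iff_card)
  then show "homology (degenerate_complex X qop) 2 \<cong> free_Abelian_group {..<m}"
    using homology_degenerate_iso iso_trans isomorphic_free_Abelian_groups by blast
  show "connecting_hom (degenerate_complex X qop) (rack_complex X qop) (quandle_complex X qop)
      incl_map (proj_map X qop) 3 \<kappa> = \<one>\<^bsub>homology (degenerate_complex X qop) 2\<^esub>"
    if "\<kappa> \<in> carrier (homology (quandle_complex X qop) 3)" for \<kappa>
    \<comment> \<open>With \<open>n = 3\<close> the condition on boundaries concerns degree
      \<open>3 - 1\<close>, where \<open>degenerate_boundaries\<close> provides it.\<close>
    using that DR.connecting_hom_eq_one[of 3 \<kappa>] degenerate_boundaries
    by (simp add: quandle_complex_def)
  show "short_exact (homology (degenerate_complex X qop) 2) (homology (rack_complex X qop) 2)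
      (homology (quandle_complex X qop) 2)
      (homology_map (degenerate_complex X qop) (rack_complex X qop) incl_map 2)
      (homology_map (rack_complex X qop) (quandle_complex X qop) (proj_map X qop) 2)"
    unfolding quandle_complex_def
    by (rule DR.short_exact_homology[OF degenerate_boundaries degenerate_chains_1])
qed

end
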